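(* Let $(X,Y,\pi,\nu)$ be a factor quadruple with finite degree $d := d_{\pi,\nu} < \infty$. Then there exists a degree joining over $\nu$ with respect to $\pi$, i.e. a $d$-fold ergodic separating $\pi$-relative joining over $\nu$ on $X^d$.
   Context: A topological dynamical system $(X,T)$ is a compact metric space $X$ with a homeomorphism $T:X\to X$. "Measure" means Borel probability measure; $E(X)=E(X,T)$ is the set of ergodic $T$-invariant measures. A factor map $\pi:(X,T)\to(Y,S)$ is a continuous surjection with $\pi\circ T=S\circ\pi$. For a measure $\mu$ on $X$, $\pi\mu$ denotes the pushforward $\mu\circ\pi^{-1}$ (similarly for other maps). A factor quadruple $(X,Y,\pi,\nu)$ consists of a factor map $\pi:(X,T)\to(Y,S)$ between topological dynamical systems and $\nu\in E(Y,S)$. The function $y\mapsto|\pi^{-1}(y)|\in\{1,2,\dots\}\cup\{\infty\}$ is $\nu$-a.e. constant; the constant is the degree $d_{\pi,\nu}$ of the quadruple. $X^n$ carries the product action $T\times\cdots\times T$, and $p_i:X^n\to X$ is the $i$-th coordinate projection. The fiber product is $X^n_\pi=\{(x_1,\dots,x_n)\in X^n:\pi(x_1)=\cdots=\pi(x_n)\}$. An $n$-fold $\pi$-relative joining is an invariant measure $\lambda$ on $X^n$ with $\lambda(X^n_\pi)=1$; it is over $\nu$ if $\pi p_i\lambda=\nu$ for some (equivalently all) $i$. It is separating if for $\lambda$-a.e. $(x_1,\dots,x_n)$ the points $x_1,\dots,x_n$ are pairwise distinct. If $d=d_{\pi,\nu}<\infty$, a degree joining over $\nu$ with respect to $\pi$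 is a $d$-fold ergodic separating $\pi$-relative joining over $\nu$ (a measure on $X^d$). *)

theory Defs
  imports "HOL-Probability.Probability"
begin

text \<open>
  Compact metric spaces are compact subsets \<open>X\<close> of a type of class \<open>metric_space\<close>; maps are total
  functions of which only the values on the carrier matter. The Borel sets of \<open>X\<close> are
  \<open>sets (restrict_space borel X)\<close>.
\<close>

definition tds :: "'a::metric_space set \<Rightarrow> ('a \<Rightarrow> 'a) \<Rightarrow> bool" where
  "tds X T \<longleftrightarrow> compact X \<and> (\<exists>T'. homeomorphism X X T T')"

definition factor_map ::
  "'a::metric_space set \<Rightarrow> ('a \<Rightarrow> 'a) \<Rightarrow> 'b::metric_space set \<Rightarrow> ('b \<Rightarrow> 'b) \<Rightarrow> ('a \<Rightarrow> 'b) \<Rightarrow> bool" where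
  "factor_map X T Y S p \<longleftrightarrow>
     tds X T \<and> tds Y S \<and> continuous_on X p \<and> p ` X = Y \<and> (\<forall>x\<in>X. p (T x) = S (p x))"

definition invariant_measures :: "'c measure \<Rightarrow> ('c \<Rightarrow> 'c) \<Rightarrow> 'c measure set" where
  "invariant_measures M T =
     {\<mu>. sets \<mu> = sets M \<and> prob_space \<mu> \<and> T \<in> measurable M M \<and> distr \<mu> M T = \<mu>}"

definition ergodic_measures :: "'c measure \<Rightarrow> ('c \<Rightarrow> 'c) \<Rightarrow> 'c measure set" where
  "ergodic_measures M T =
     {\<mu> \<in> invariant_measures M T.
        \<forall>A\<in>sets M. T -` A \<inter> space M = A \<longrightarrow> measure \<mu> A = 0 \<or> measure \<mu> A = 1}"

definition factor_quadruple ::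
  "'a::metric_space set \<Rightarrow> ('a \<Rightarrow> 'a) \<Rightarrow> 'b::metric_space set \<Rightarrow> ('b \<Rightarrow> 'b)
     \<Rightarrow> ('a \<Rightarrow> 'b) \<Rightarrow> 'b measure \<Rightarrow> bool" where
  "factor_quadruple X T Y S p \<nu> \<longleftrightarrow>
     factor_map X T Y S p \<and> \<nu> \<in> ergodic_measures (restrict_space borel Y) S"

definition ecard :: "'c set \<Rightarrow> enat" where
  "ecard A = (if finite A then enat (card A) else \<infinity>)"

definition fiber_degree :: "'a set \<Rightarrow> ('a \<Rightarrow> 'b) \<Rightarrow> 'b measure \<Rightarrow> enat" where
  "fiber_degree X p \<nu> = (THE d. AE y in \<nu>. ecard {x \<in> X. p x = y} = d)"

lemma fiber_degree_eqI:
  assumes "prob_space \<nu>" and "AE y in \<nu>. ecard {x \<in> X. p x = y} = d"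
  shows "fiber_degree X p \<nu> = d"
  unfolding fiber_degree_def
proof (rule the_equality)
  fix e assume "AE y in \<nu>. ecard {x \<in> X. p x = y} = e"
  with assms(2) have "AE y in \<nu>. e = d" by eventually_elim simp
  with assms(1) show "e = d" by (simp add: prob_space.AE_const)
qed (fact assms(2))

text \<open>
  The power \<open>X\<^sup>n\<close> is indexed by \<open>{..<n}\<close>, i.e. coordinates are numbered from 0, and its points are
  the extensional functions in \<open>Pi\<^sub>E {..<n} (\<lambda>_. X)\<close>. Its Borel sets are those of the product measurable
  space; lemma \<open>sets_power_space\<close> shows that these are generated by the product topology.
\<close>

definition power_space :: "nat \<Rightarrow> 'a::metric_space set \<Rightarrow> (nat \<Rightarrow> 'a) measure" where
  "power_space n X = Pi\<^sub>M {..<n} (\<lambda>_. restrict_space borel X)"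

lemma space_power_space: "space (power_space n X) = Pi\<^sub>E {..<n} (\<lambda>_. X)"
  by (simp add: power_space_def space_PiM space_restrict_space)

lemma compact_countable_base:
  fixes X :: "'a::metric_space set"
  assumes "compact X"
  obtains \<B> where "countable \<B>" "\<And>B. B \<in> \<B> \<Longrightarrow> openin (top_of_set X) B"
    "\<And>U x. openin (top_of_set X) U \<Longrightarrow> x \<in> U \<Longrightarrow> \<exists>B\<in>\<B>. x \<in> B \<and> B \<subseteq> U"
proof -
  have "\<exists>K. finite K \<and> K \<subseteq> X \<and> X \<subseteq> (\<Union>c\<in>K. ball c (inverse (Suc n)))" for n
    using compactE_image[OF assms, of X "\<lambda>c. ball c (inverse (Suc n))"]
    by (smt (verit) UN_I centre_in_ball inverse_positive_iff_positive of_nat_0_less_iff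
        open_ball subsetI zero_less_Suc)
  then obtain K where K: "finite (K n)" "K n \<subseteq> X"
      "X \<subseteq> (\<Union>c\<in>K n. ball c (inverse (Suc n)))" for n
    by metis
  define \<B> where "\<B> = (\<Union>n. (\<lambda>c. X \<inter> ball c (inverse (Suc n))) ` K n)"
  show thesis
  proof
    show "countable \<B>"
      unfolding \<B>_def using K(1) by (intro countable_UN countable_image) (auto intro: countable_finite)
    show "openin (top_of_set X) B" if "B \<in> \<B>" for B
      using that by (auto simp: \<B>_def openin_open)
    fix U x assume U: "openin (top_of_set X) U" "x \<in> U"
    then obtain e where e: "e > 0" "\<And>y. y \<in> X \<Longrightarrow> dist y x < e \<Longrightarrow> y \<in> U" and "x \<in> X"
      unfolding openin_euclidean_subtopology_iff by blast
    obtain n where n: "inverse (real (Suc n)) < e / 2"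
      using e(1) reals_Archimedean[of "e/2"] by auto
    obtain c where c: "c \<in> K n" "x \<in> ball c (inverse (Suc n))"
      using K(3) \<open>x \<in> X\<close> by blast
    have "X \<inter> ball c (inverse (Suc n)) \<subseteq> U"
    proof
      fix y assume "y \<in> X \<inter> ball c (inverse (Suc n))"
      then have "y \<in> X" "dist c y < e / 2" using n by auto
      moreover have "dist c x < e / 2" using c(2) n by auto
      ultimately show "y \<in> U" by (intro e(2)) (auto intro: dist_triangle_half_r)
    qed
    with c \<open>x \<in> X\<close> show "\<exists>B\<in>\<B>. x \<in> B \<and> B \<subseteq> U"
      unfolding \<B>_def by (intro bexI[of _ "X \<inter> ball c (inverse (Suc n))"]) auto
  qed
qed

lemma sets_power_space:
  fixes X :: "'a::metric_space set"
  assumes "compact X"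
  shows "sets (power_space n X) =
    sigma_sets (Pi\<^sub>E {..<n} (\<lambda>_. X)) {U. openin (product_topology (\<lambda>_. top_of_set X) {..<n}) U}"
    (is "_ = sigma_sets ?P ?O")
proof
  let ?S = "sigma ?P ?O"
  have sub: "?O \<subseteq> Pow ?P"
  proof
    fix U assume "U \<in> ?O"
    then show "U \<in> Pow ?P"
      using openin_subset[of "product_topology (\<lambda>_. top_of_set X) {..<n}" U] by simp
  qed
  have box: "Pi\<^sub>E {..<n} B \<in> sets (power_space n X)"
    if "\<And>i. i < n \<Longrightarrow> openin (top_of_set X) (B i)" for B
    unfolding power_space_def
  proof (rule sets_PiM_I_finite)
    fix i assume "i \<in> {..<n}"
    with that obtain W where "open W" "B i = X \<inter> W" by (auto simp: openin_open)
    then show "B i \<in> sets (restrict_space borel X)" by (auto simp: sets_restrict_space)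
  qed simp
  obtain \<B> where \<B>: "countable \<B>" "\<And>B. B \<in> \<B> \<Longrightarrow> openin (top_of_set X) B"
    "\<And>U x. openin (top_of_set X) U \<Longrightarrow> x \<in> U \<Longrightarrow> \<exists>B\<in>\<B>. x \<in> B \<and> B \<subseteq> U"
    using compact_countable_base[OF assms] by metis
  have "U \<in> sets (power_space n X)" if U: "U \<in> ?O" for U
  proof -
    define F where "F = {B \<in> Pi\<^sub>E {..<n} (\<lambda>_. \<B>). Pi\<^sub>E {..<n} B \<subseteq> U}"
    have "countable F"
      unfolding F_def using countable_PiE[of "{..<n}" "\<lambda>_. \<B>"] \<B>(1)
      by (auto intro: countable_subset[rotated])
    have "U = (\<Union>B\<in>F. Pi\<^sub>E {..<n} B)"
    proof
      show "U \<subseteq> (\<Union>B\<in>F. Pi\<^sub>E {..<n} B)"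
      proof
        fix x assume x: "x \<in> U"
        have "\<forall>x\<in>U. \<exists>V. finite {i \<in> {..<n}. V i \<noteq> topspace (top_of_set X)} \<and>
            (\<forall>i\<in>{..<n}. openin (top_of_set X) (V i)) \<and> x \<in> Pi\<^sub>E {..<n} V \<and> Pi\<^sub>E {..<n} V \<subseteq> U"
          using U unfolding openin_product_topology_alt mem_Collect_eq .
        with x obtain V where V: "\<And>i. i < n \<Longrightarrow> openin (top_of_set X) (V i)"
            "x \<in> Pi\<^sub>E {..<n} V" "Pi\<^sub>E {..<n} V \<subseteq> U"
          by (meson lessThan_iff)
        have "\<exists>B\<in>\<B>. x i \<in> B \<and> B \<subseteq> V i" if "i < n" for i
          using \<B>(3)[OF V(1)[OF that]] V(2) that by auto
        then obtain B where B: "\<And>i. i < n \<Longrightarrow> B i \<in> \<B> \<and> x i \<in> B i \<and> B i \<subseteq> V i"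
          by metis
        define C where "C = restrict B {..<n}"
        have "Pi\<^sub>E {..<n} C \<subseteq> Pi\<^sub>E {..<n} V"
          using B by (intro PiE_mono) (auto simp: C_def)
        then have "C \<in> F" using B V(3) by (auto simp: F_def C_def)
        moreover have "x \<in> Pi\<^sub>E {..<n} C"
          using B V(2) by (auto simp: C_def PiE_iff)
        ultimately show "x \<in> (\<Union>B\<in>F. Pi\<^sub>E {..<n} B)" by blast
      qed
    qed (auto simp: F_def)
    also have "\<dots> \<in> sets (power_space n X)"
      using \<open>countable F\<close> by (intro sets.countable_UN'' box \<B>(2)) (auto simp: F_def)
    finally show ?thesis .
  qed
  then show "sigma_sets ?P ?O \<subseteq> sets (power_space n X)"
    using sets.sigma_sets_subset[of ?O "power_space n X"] unfolding space_power_space by blast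
  have "(\<lambda>x. x) \<in> measurable ?S (power_space n X)"
    unfolding power_space_def
  proof (rule measurable_PiM_single')
    fix i assume i: "i \<in> {..<n}"
    have "(\<lambda>x. x i) \<in> borel_measurable ?S"
    proof (rule borel_measurableI)
      fix W :: "'a set" assume "open W"
      then have "openin (top_of_set X) (X \<inter> W)" by (auto simp: openin_open)
      then have "{x \<in> ?P. x i \<in> X \<inter> W} \<in> ?O"
        using openin_continuous_map_preimage[OF
            continuous_map_product_projection[OF i, where X = "\<lambda>_. top_of_set X"], of "X \<inter> W"]
        by simp
      moreover have "(\<lambda>x. x i) -` W \<inter> space ?S = {x \<in> ?P. x i \<in> X \<inter> W}"
        using i sub by (auto simp: space_measure_of)
      ultimately show "(\<lambda>x. x i) -` W \<inter> space ?S \<in> sets ?S"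
        using sub by (simp add: sets_measure_of sigma_sets.Basic)
    qed
    then show "(\<lambda>x. x i) \<in> measurable ?S (restrict_space borel X)"
      using i sub by (intro measurable_restrict_space2) (auto simp: space_measure_of)
  qed (use sub in \<open>auto simp: space_measure_of space_restrict_space\<close>)
  then show "sets (power_space n X) \<subseteq> sigma_sets ?P ?O"
    using sub sets.sets_into_space[of _ "power_space n X"]
    by (auto simp: measurable_def space_power_space space_measure_of sets_measure_of Int_absorb2)
qed

definition power_map :: "nat \<Rightarrow> ('a \<Rightarrow> 'a) \<Rightarrow> (nat \<Rightarrow> 'a) \<Rightarrow> (nat \<Rightarrow> 'a)" where
  "power_map n T x = (\<lambda>i\<in>{..<n}. T (x i))"

definition fiber_product :: "nat \<Rightarrow> 'a set \<Rightarrow> ('a \<Rightarrow> 'b) \<Rightarrow> (nat \<Rightarrow> 'a) set" where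
  "fiber_product n X p = {x \<in> Pi\<^sub>E {..<n} (\<lambda>_. X). \<forall>i<n. \<forall>j<n. p (x i) = p (x j)}"

definition relative_joining ::
  "nat \<Rightarrow> 'a::metric_space set \<Rightarrow> ('a \<Rightarrow> 'a) \<Rightarrow> ('a \<Rightarrow> 'b) \<Rightarrow> (nat \<Rightarrow> 'a) measure \<Rightarrow> bool" where
  "relative_joining n X T p J \<longleftrightarrow>
     J \<in> invariant_measures (power_space n X) (power_map n T) \<and> measure J (fiber_product n X p) = 1"

definition joining_over ::
  "nat \<Rightarrow> 'b::metric_space set \<Rightarrow> ('a \<Rightarrow> 'b) \<Rightarrow> 'b measure \<Rightarrow> (nat \<Rightarrow> 'a) measure \<Rightarrow> bool" where
  "joining_over n Y p \<nu> J \<longleftrightarrow> (\<exists>i<n. distr J (restrict_space borel Y) (\<lambda>x. p (x i)) = \<nu>)"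

definition separating :: "nat \<Rightarrow> (nat \<Rightarrow> 'a) measure \<Rightarrow> bool" where
  "separating n J \<longleftrightarrow> (AE x in J. \<forall>i<n. \<forall>j<n. i \<noteq> j \<longrightarrow> x i \<noteq> x j)"

definition degree_joining ::
  "'a::metric_space set \<Rightarrow> ('a \<Rightarrow> 'a) \<Rightarrow> 'b::metric_space set \<Rightarrow> ('a \<Rightarrow> 'b) \<Rightarrow> 'b measure
     \<Rightarrow> (nat \<Rightarrow> 'a) measure \<Rightarrow> bool" where
  "degree_joining X T Y p \<nu> J \<longleftrightarrow>
     (\<exists>d. fiber_degree X p \<nu> = enat d \<and>
        relative_joining d X T p J \<and> joining_over d Y p \<nu> J \<and> separating d J \<and>
        J \<in> ergodic_measures (power_space d X) (power_map d T))"

end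

theory Submission
  imports Defs
begin

text \<open>
  Over almost every \<open>y\<close>, let \<open>F y\<close> be the finite set of injective enumerations of the fiber of \<open>y\<close>;
  the product map sends \<open>F y\<close> bijectively to \<open>F (S y)\<close>. For an invariant Borel set \<open>A\<close> the number
  \<open>card (A \<inter> F y)\<close> is almost surely constant by ergodicity of \<open>\<nu>\<close>. An invariant set \<open>E\<close> for which this
  constant \<open>k\<close> is positive and minimal cannot be split further, so integrating the uniform measures on
  \<open>E \<inter> F y\<close> against \<open>\<nu>\<close> gives an ergodic measure, without appeal to ergodic decomposition or to
  measurable selection. Measurability of \<open>y \<mapsto> card (A \<inter> F y)\<close> reduces by Dynkin's lemma to boxes of
  compact sets, where at least \<open>m\<close> points lie over \<open>y\<close> iff \<open>y\<close> is in the image of \<open>m\<close> disjoint compact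
  sets from a suitable countable family.
\<close>

section \<open>Ergodic measures on finite extensions of an ergodic system\<close>

text \<open>Each level set of \<open>g\<close> is invariant, hence has measure 0 or 1. As there are
  only countably many values, the level sets cannot all be null.\<close>

lemma ergodic_invariant_AE_const:
  fixes g :: "'c \<Rightarrow> 'k::countable"
  assumes erg: "\<nu> \<in> ergodic_measures N S"
    and meas: "\<And>k. {y \<in> space N. g y = k} \<in> sets N"
    and inv: "\<And>y. y \<in> space N \<Longrightarrow> g (S y) = g y"
  obtains k where "AE y in \<nu>. g y = k"
proof -
  from erg have sets: "sets \<nu> = sets N" and S: "S \<in> measurable N N" and "prob_space \<nu>"
    by (auto simp: ergodic_measures_def invariant_measures_def)
  interpret prob_space \<nu> by fact
  have sp: "space \<nu> = space N" using sets by (rule sets_eq_imp_space_eq)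
  have "S -` {y \<in> space N. g y = k} \<inter> space N = {y \<in> space N. g y = k}" for k
    using inv measurable_space[OF S] by auto
  then have dich: "prob {y \<in> space N. g y = k} = 0 \<or> prob {y \<in> space N. g y = k} = 1" for k
    using erg meas[of k] by (auto simp: ergodic_measures_def)
  have "\<exists>k. prob {y \<in> space N. g y = k} = 1"
  proof (rule ccontr)
    assume "\<not> ?thesis"
    with dich have "prob {y \<in> space N. g y = k} = 0" for k by metis
    then have "AE y in \<nu>. g y \<noteq> k" for k
      using meas[of k] by (subst AE_iff_measurable[OF _ refl]) (auto simp: sets sp emeasure_eq_measure)
    then have "AE y in \<nu>. \<forall>k. g y \<noteq> k" unfolding AE_all_countable by blast
    then show False by simp
  qed
  then obtain k where "prob {y \<in> space N. g y = k} = 1" ..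
  then have "AE y in \<nu>. y \<in> {y \<in> space N. g y = k}"
    using meas[of k] by (subst AE_in_set_eq_1) (auto simp: sets)
  then show thesis by (intro that[of k]) auto
qed

text \<open>The three conclusions are what a joining needs: ergodicity; transfer of any property
  shared by all points of all \<open>F y\<close> to \<open>L\<close>-almost every point; and
  projection to \<open>\<nu>\<close>. Invariance of \<open>L\<close> comes from that of
  \<open>\<nu>\<close> because \<open>R\<close> matches \<open>F y\<close> with
  \<open>F (S y)\<close> point by point.\<close>

lemma ergodic_finite_extension:
  assumes erg: "\<nu> \<in> ergodic_measures N S"
    and R: "R \<in> measurable M M"
    and fin: "\<And>y. y \<in> space N \<Longrightarrow> finite (F y)"
    and sub: "\<And>y. y \<in> space N \<Longrightarrow> F y \<subseteq> space M"
    and bij: "\<And>y. y \<in> space N \<Longrightarrow> bij_betw R (F y) (F (S y))"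
    and meas: "\<And>A. A \<in> sets M \<Longrightarrow> (\<lambda>y. emeasure (count_space UNIV) (A \<inter> F y)) \<in> borel_measurable N"
    and ne: "AE y in \<nu>. F y \<noteq> {}"
  obtains L where "L \<in> ergodic_measures M R"
    and "\<And>A. A \<in> sets M \<Longrightarrow> (\<And>y. y \<in> space N \<Longrightarrow> F y \<subseteq> A) \<Longrightarrow> emeasure L A = 1"
    and "\<And>q. q \<in> measurable M N \<Longrightarrow> (\<And>y x. y \<in> space N \<Longrightarrow> x \<in> F y \<Longrightarrow> q x = y) \<Longrightarrow> distr L N q = \<nu>"
proof -
  from erg have sets: "sets \<nu> = sets N" and S: "S \<in> measurable N N" and "prob_space \<nu>"
    and invS: "distr \<nu> N S = \<nu>"
    by (auto simp: ergodic_measures_def invariant_measures_def)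
  interpret prob_space \<nu> by fact
  have sp: "space \<nu> = space N" using sets by (rule sets_eq_imp_space_eq)
  have mN: "measurable \<nu> K = measurable N K" for K :: "'c measure"
    by (rule measurable_cong_sets[OF sets refl])
  have mNe: "borel_measurable \<nu> = (borel_measurable N :: (_ \<Rightarrow> ennreal) set)"
    by (rule measurable_cong_sets[OF sets refl])
  \<comment> \<open>Counts are taken in \<open>ennreal\<close> so that they can be summed over
    infinite disjoint families and integrated; \<open>e_card\<close> leads back to
    \<open>card\<close>.\<close>
  let ?e = "emeasure (count_space UNIV) :: 'b set \<Rightarrow> ennreal"
  have e_card: "?e (A \<inter> F y) = of_nat (card (A \<inter> F y))" if "y \<in> space N" for A y
    using emeasure_count_space_finite[of "A \<inter> F y" UNIV] fin[OF that] by simp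
  have card_R: "card ((R -` A \<inter> space M) \<inter> F y) = card (A \<inter> F (S y))" if "y \<in> space N" for A y
  proof -
    have "inj_on R (F y)" and im: "R ` F y = F (S y)"
      using bij[OF that] by (auto simp: bij_betw_def)
    moreover have "R ` ((R -` A \<inter> space M) \<inter> F y) = A \<inter> F (S y)"
      using sub[OF that] unfolding im[symmetric] by auto
    ultimately have "bij_betw R ((R -` A \<inter> space M) \<inter> F y) (A \<inter> F (S y))"
      by (auto simp: bij_betw_def intro: inj_on_subset)
    then show ?thesis by (rule bij_betw_same_card)
  qed
  define Inv where "Inv = {A \<in> sets M. R -` A \<inter> space M = A}"
  have InvI: "A \<inter> B \<in> Inv" if "A \<in> Inv" "B \<in> Inv" for A B
    using that by (auto simp: Inv_def)
  have const: "\<exists>k. AE y in \<nu>. card (A \<inter> F y) = k" if "A \<in> Inv" for A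
  proof (rule ergodic_invariant_AE_const[OF erg, of "\<lambda>y. card (A \<inter> F y)"])
    have A: "A \<in> sets M" "R -` A \<inter> space M = A" using that by (auto simp: Inv_def)
    have "{y \<in> space N. ?e (A \<inter> F y) = of_nat k} \<in> sets N" for k
      using measurable_sets[OF meas[OF A(1)], of "{of_nat k}"] by (simp add: vimage_def Int_def conj_commute)
    also have "{y \<in> space N. ?e (A \<inter> F y) = of_nat k} = {y \<in> space N. card (A \<inter> F y) = k}" for k
      using e_card by auto
    finally show "{y \<in> space N. card (A \<inter> F y) = k} \<in> sets N" for k .
    show "card (A \<inter> F (S y)) = card (A \<inter> F y)" if "y \<in> space N" for y
      using card_R[OF that, of A] A(2) by simp
  qed auto
  \<comment> \<open>The positive values that occur as the almost sure fiber count of an invariant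
    set. The whole space supplies one, since almost every \<open>F y\<close> is nonempty; the least
    one replaces an ergodic decomposition.\<close>
  define P where "P k \<longleftrightarrow> k > 0 \<and> (\<exists>A\<in>Inv. AE y in \<nu>. card (A \<inter> F y) = k)" for k
  have "\<exists>k. P k"
  proof -
    have spM: "space M \<in> Inv" using measurable_space[OF R] by (auto simp: Inv_def)
    then obtain k where k: "AE y in \<nu>. card (space M \<inter> F y) = k" using const by blast
    have "AE y in \<nu>. k > 0"
      using k ne AE_space
    proof eventually_elim
      case (elim y)
      then show ?case using sub[of y] fin[of y] by (auto simp: sp Int_absorb1 card_gt_0_iff)
    qed
    then have "k > 0" by simp
    with spM k show ?thesis unfolding P_def by blast
  qed
  define k where "k = (LEAST k. P k)"
  have "P k" and least: "\<And>j. P j \<Longrightarrow> k \<le> j"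
    unfolding k_def using \<open>\<exists>k. P k\<close> by (auto intro: LeastI_ex Least_le)
  then obtain E where "k > 0" and E: "E \<in> Inv" and kE: "AE y in \<nu>. card (E \<inter> F y) = k"
    unfolding P_def by blast
  have E_sets [measurable]: "E \<in> sets M" and E_inv: "R -` E \<inter> space M = E"
    using E by (auto simp: Inv_def)
  \<comment> \<open>The \<open>\<nu>\<close>-average of the uniform measures on
    \<open>E \<inter> F y\<close>. Dividing by the constant \<open>k\<close> normalizes, because
    almost every such set has exactly \<open>k\<close> points.\<close>
  define m where "m A = (\<integral>\<^sup>+ y. ?e (A \<inter> (E \<inter> F y)) / of_nat k \<partial>\<nu>)" for A
  have me: "(\<lambda>y. ?e (A \<inter> (E \<inter> F y))) \<in> borel_measurable \<nu>" if "A \<in> sets M" for A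
    using meas[of "A \<inter> E"] that by (simp add: Int_assoc mNe)
  define L where "L = measure_of (space M) (sets M) m"
  have sets_L: "sets L = sets M" and space_L: "space L = space M"
    by (simp_all add: L_def)
  have mL: "measurable L K = measurable M K" for K :: "'d measure"
    by (rule measurable_cong_sets[OF sets_L refl])
  have em: "emeasure L A = m A" if "A \<in> sets M" for A
    unfolding L_def
  proof (rule emeasure_measure_of_sigma)
    show "countably_additive (sets M) m"
    \<comment> \<open>Counting is countably additive on each fiber, and the sum may be exchanged
      with the integral of nonnegative functions.\<close>
    proof (rule countably_additiveI)
      fix A :: "nat \<Rightarrow> 'b set"
      assume A: "range A \<subseteq> sets M" "disjoint_family A" "(\<Union>i. A i) \<in> sets M"
      have "(\<Sum>i. m (A i)) = (\<integral>\<^sup>+ y. (\<Sum>i. ?e (A i \<inter> (E \<inter> F y)) / of_nat k) \<partial>\<nu>)"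
        unfolding m_def using A me by (subst nn_integral_suminf) (auto intro!: borel_measurable_divide_ennreal)
      also have "\<dots> = m (\<Union>i. A i)"
        unfolding m_def
      proof (rule nn_integral_cong)
        fix y
        have "(\<Sum>i. ?e (A i \<inter> (E \<inter> F y)) / of_nat k) = (\<Sum>i. ?e (A i \<inter> (E \<inter> F y))) / of_nat k"
          by (rule ennreal_suminf_divide)
        also have "(\<Sum>i. ?e (A i \<inter> (E \<inter> F y))) = ?e (\<Union>i. A i \<inter> (E \<inter> F y))"
          using A(2) by (intro suminf_emeasure) (auto simp: disjoint_family_on_def)
        also have "(\<Union>i. A i \<inter> (E \<inter> F y)) = (\<Union>i. A i) \<inter> (E \<inter> F y)" by auto
        finally show "(\<Sum>i. ?e (A i \<inter> (E \<inter> F y)) / of_nat k) = ?e ((\<Union>i. A i) \<inter> (E \<inter> F y)) / of_nat k" .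
      qed
      finally show "(\<Sum>i. m (A i)) = m (\<Union>i. A i)" .
    qed
  qed (use that in \<open>auto simp: positive_def m_def sets.sigma_algebra_axioms\<close>)
  have kk: "of_nat k / of_nat k = (1 :: ennreal)"
    using \<open>k > 0\<close> by (subst ennreal_divide_self) (auto simp: of_nat_less_top)
  \<comment> \<open>Serves twice: for sets that contain every fiber, and for invariant sets whose
    count attains the minimum \<open>k\<close>.\<close>
  have m1: "m A = 1" if "A \<in> sets M" "AE y in \<nu>. card (A \<inter> (E \<inter> F y)) = k" for A
  proof -
    have "m A = (\<integral>\<^sup>+ y. 1 \<partial>\<nu>)"
      unfolding m_def
    proof (rule nn_integral_cong_AE)
      show "AE y in \<nu>. ?e (A \<inter> (E \<inter> F y)) / of_nat k = 1"
        using that(2) AE_space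
        by eventually_elim (use kk e_card[of _ "A \<inter> E"] in \<open>auto simp: sp Int_assoc\<close>)
    qed
    then show ?thesis by (simp add: emeasure_space_1)
  qed
  have m_full: "m A = 1" if "A \<in> sets M" "\<And>y. y \<in> space N \<Longrightarrow> F y \<subseteq> A" for A
  proof (rule m1[OF that(1)])
    show "AE y in \<nu>. card (A \<inter> (E \<inter> F y)) = k"
      using kE AE_space
    proof eventually_elim
      case (elim y)
      then have "A \<inter> (E \<inter> F y) = E \<inter> F y" using that(2)[of y] by (auto simp: sp)
      with elim show ?case by simp
    qed
  qed
  have "prob_space L"
    by (rule prob_spaceI) (use em[of "space M"] m_full[of "space M"] sub in \<open>auto simp: space_L\<close>)
  interpret L: prob_space L by fact
  \<comment> \<open>By \<open>card_R\<close> and the invariance of \<open>E\<close>, the integrand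
    of the \<open>R\<close>-preimage of \<open>A\<close> at \<open>y\<close> is the integrand of
    \<open>A\<close> at \<open>S y\<close>; the \<open>S\<close>-invariance of \<open>\<nu>\<close>
    then removes the \<open>S\<close>.\<close>
  have dR: "distr L M R = L"
  proof (rule measure_eqI)
    fix A assume "A \<in> sets (distr L M R)"
    then have A [measurable]: "A \<in> sets M" by simp
    have RA: "R -` A \<inter> space M \<in> sets M" using R by measurable
    have "emeasure (distr L M R) A = emeasure L (R -` A \<inter> space M)"
      using R A by (subst emeasure_distr) (simp_all add: space_L mL)
    also have "\<dots> = m (R -` A \<inter> space M)" by (rule em[OF RA])
    also have "\<dots> = (\<integral>\<^sup>+ y. ?e (A \<inter> (E \<inter> F (S y))) / of_nat k \<partial>\<nu>)"
      unfolding m_def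
    proof (rule nn_integral_cong)
      fix y assume "y \<in> space \<nu>"
      then have y: "y \<in> space N" "S y \<in> space N" using measurable_space[OF S] by (auto simp: sp)
      have eq: "(R -` A \<inter> space M) \<inter> (E \<inter> F y) = (R -` (A \<inter> E) \<inter> space M) \<inter> F y"
        using E_inv by blast
      have "?e ((R -` A \<inter> space M) \<inter> (E \<inter> F y)) = of_nat (card (A \<inter> E \<inter> F (S y)))"
        unfolding eq using e_card[OF y(1)] card_R[OF y(1), of "A \<inter> E"] by simp
      also have "\<dots> = ?e (A \<inter> (E \<inter> F (S y)))"
        using e_card[OF y(2), of "A \<inter> E"] by (simp add: Int_assoc)
      finally show "?e ((R -` A \<inter> space M) \<inter> (E \<inter> F y)) / of_nat k = ?e (A \<inter> (E \<inter> F (S y))) / of_nat k"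
        by simp
    qed
    also have "\<dots> = (\<integral>\<^sup>+ y. ?e (A \<inter> (E \<inter> F y)) / of_nat k \<partial>distr \<nu> N S)"
      using S me[OF A] by (subst nn_integral_distr) (auto simp: mN mNe intro!: borel_measurable_divide_ennreal)
    also have "\<dots> = emeasure L A" unfolding invS m_def[symmetric] by (rule em[OF A, symmetric])
    finally show "emeasure (distr L M R) A = emeasure L A" .
  qed (simp add: sets_L)
  have "L.prob A = 0 \<or> L.prob A = 1" if A: "A \<in> Inv" for A
  proof -
    have As: "A \<in> sets M" using A by (simp add: Inv_def)
    \<comment> \<open>The set \<open>A \<inter> E\<close> is again invariant, so its count
      \<open>j \<le> k\<close> is either 0 or, by minimality, equal to \<open>k\<close>. These two
      cases give measure 0 and measure 1.\<close>
    obtain j where j: "AE y in \<nu>. card ((A \<inter> E) \<inter> F y) = j" using const InvI[OF A E] by blast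
    have "AE y in \<nu>. j \<le> k"
      using j kE AE_space
    proof eventually_elim
      case (elim y)
      have "card ((A \<inter> E) \<inter> F y) \<le> card (E \<inter> F y)"
        using elim fin[of y] by (intro card_mono) (auto simp: sp)
      with elim show ?case by simp
    qed
    then have jk: "j \<le> k" by simp
    show ?thesis
    proof (cases "j = 0")
      case True
      have "m A = (\<integral>\<^sup>+ y. 0 \<partial>\<nu>)"
        unfolding m_def
      proof (rule nn_integral_cong_AE)
        show "AE y in \<nu>. ?e (A \<inter> (E \<inter> F y)) / of_nat k = 0"
          using j AE_space
          by eventually_elim (use e_card[of _ "A \<inter> E"] True in \<open>auto simp: sp Int_assoc\<close>)
      qed
      then show ?thesis using em[OF As] by (simp add: measure_def)
    next
      case False
      then have "k \<le> j" using j InvI[OF A E] by (intro least) (auto simp: P_def)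
      with jk j have "m A = 1" by (intro m1[OF As]) (auto simp: Int_assoc)
      then show ?thesis using em[OF As] by (simp add: measure_def)
    qed
  qed
  then have "L \<in> ergodic_measures M R"
    using \<open>prob_space L\<close> R dR sets_L by (auto simp: ergodic_measures_def invariant_measures_def Inv_def)
  moreover have "distr L N q = \<nu>"
    if q: "q \<in> measurable M N" and qF: "\<And>y x. y \<in> space N \<Longrightarrow> x \<in> F y \<Longrightarrow> q x = y" for q
  proof (rule measure_eqI)
    fix B assume "B \<in> sets (distr L N q)"
    then have B: "B \<in> sets N" by simp
    have qB: "q -` B \<inter> space M \<in> sets M" using q B by (rule measurable_sets)
    have "emeasure (distr L N q) B = emeasure L (q -` B \<inter> space M)"
      using q B by (subst emeasure_distr) (simp_all add: space_L mL)
    also have "\<dots> = m (q -` B \<inter> space M)" by (rule em[OF qB])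
    also have "\<dots> = (\<integral>\<^sup>+ y. indicator B y \<partial>\<nu>)"
      unfolding m_def
    proof (rule nn_integral_cong_AE)
      show "AE y in \<nu>. ?e ((q -` B \<inter> space M) \<inter> (E \<inter> F y)) / of_nat k = indicator B y"
        using kE AE_space
      proof eventually_elim
        case (elim y)
        then have y: "y \<in> space N" by (simp add: sp)
        \<comment> \<open>Since \<open>q\<close> is constantly \<open>y\<close> on
          \<open>F y\<close>, a preimage under \<open>q\<close> takes all of the fiber or none of
          it.\<close>
        have "(q -` B \<inter> space M) \<inter> (E \<inter> F y) = (if y \<in> B then E \<inter> F y else {})"
          using qF[OF y] sub[OF y] by auto
        then show ?case using e_card[OF y, of E] elim kk by (auto simp: indicator_def)
      qed
    qed
    also have "\<dots> = emeasure \<nu> B" using B sets by simp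
    finally show "emeasure (distr L N q) B = emeasure \<nu> B" .
  qed (simp add: sets)
  ultimately show thesis using em m_full by (intro that[of L]) auto
qed

section \<open>Measurability of the number of points in a fiber\<close>

lemma enat_le_ecard_iff: "enat m \<le> ecard A \<longleftrightarrow> (\<exists>B\<subseteq>A. finite B \<and> card B = m)"
proof (cases "finite A")
  case True
  then have "enat m \<le> ecard A \<longleftrightarrow> m \<le> card A" by (simp add: ecard_def)
  then show ?thesis
    using True by (metis card_mono finite_subset obtain_subset_with_card_n)
next
  case False
  then have "enat m \<le> ecard A" by (simp add: ecard_def)
  then show ?thesis using infinite_arbitrarily_large[OF False, of m] by blast
qed

lemma emeasure_count_space_UNIV_ecard: "emeasure (count_space UNIV) A = ennreal_of_enat (ecard A)"
  by (cases "finite A") (auto simp: ecard_def)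

text \<open>Relative closures of the members of a countable base suffice: around each point of a
  finite set there is one so small that it misses those chosen for the other points.\<close>

lemma compact_countable_separating_family:
  fixes X :: "'a::metric_space set"
  assumes "compact X"
  obtains \<C> where "countable \<C>" "\<And>C. C \<in> \<C> \<Longrightarrow> compact C \<and> C \<subseteq> X"
    "\<And>B. finite B \<Longrightarrow> B \<subseteq> X \<Longrightarrow> \<exists>f. (\<forall>x\<in>B. f x \<in> \<C> \<and> x \<in> f x) \<and> disjoint_family_on f B"
proof -
  obtain \<B> where \<B>: "countable \<B>" "\<And>B. B \<in> \<B> \<Longrightarrow> openin (top_of_set X) B"
    "\<And>U x. openin (top_of_set X) U \<Longrightarrow> x \<in> U \<Longrightarrow> \<exists>B\<in>\<B>. x \<in> B \<and> B \<subseteq> U"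
    using compact_countable_base[OF assms] by metis
  show thesis
  proof
    show "countable ((\<lambda>B. X \<inter> closure B) ` \<B>)" using \<B>(1) by simp
    show "compact C \<and> C \<subseteq> X" if "C \<in> (\<lambda>B. X \<inter> closure B) ` \<B>" for C
      using that assms by auto
    fix B assume B: "finite B" "B \<subseteq> X"
    have "\<exists>\<delta>>0. \<forall>y\<in>B. y \<noteq> x \<longrightarrow> \<delta> \<le> dist x y" for x
      using finite_set_avoid[OF B(1)] .
    \<comment> \<open>With radius \<open>\<delta> x / 3\<close>, a point common to the sets of
      \<open>x\<close> and \<open>y\<close> would give
      \<open>dist x y \<le> (\<delta> x + \<delta> y) / 3\<close>, which is at most two thirds of
      \<open>dist x y\<close>.\<close>
    then obtain \<delta> where \<delta>: "\<And>x. \<delta> x > 0" "\<And>x y. y \<in> B \<Longrightarrow> y \<noteq> x \<Longrightarrow> \<delta> x \<le> dist x y"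
      by metis
    have "\<exists>C\<in>(\<lambda>B. X \<inter> closure B) ` \<B>. x \<in> C \<and> C \<subseteq> cball x (\<delta> x / 3)" if xB: "x \<in> B" for x
    proof -
      obtain V where V: "V \<in> \<B>" "x \<in> V" "V \<subseteq> X \<inter> ball x (\<delta> x / 3)"
        using \<B>(3)[of "X \<inter> ball x (\<delta> x / 3)" x] xB B(2) \<delta>(1)[of x] openin_open_Int[of "ball x (\<delta> x / 3)" X]
        by auto
      have "V \<subseteq> cball x (\<delta> x / 3)" using V(3) ball_subset_cball by blast
      then have "closure V \<subseteq> cball x (\<delta> x / 3)" by (rule closure_minimal) simp
      moreover have "x \<in> X \<inter> closure V" using V(2) xB B(2) closure_subset by blast
      ultimately show ?thesis using V(1) by blast
    qed
    then obtain f where f: "\<And>x. x \<in> B \<Longrightarrow> f x \<in> (\<lambda>B. X \<inter> closure B) ` \<B>"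
      "\<And>x. x \<in> B \<Longrightarrow> x \<in> f x" "\<And>x. x \<in> B \<Longrightarrow> f x \<subseteq> cball x (\<delta> x / 3)"
      by metis
    have "f x \<inter> f y = {}" if xy: "x \<in> B" "y \<in> B" "x \<noteq> y" for x y
    proof (rule equals0I)
      fix z assume "z \<in> f x \<inter> f y"
      then have "dist x z \<le> \<delta> x / 3" "dist y z \<le> \<delta> y / 3"
        using f(3)[OF xy(1)] f(3)[OF xy(2)] by auto
      moreover have "\<delta> x \<le> dist x y" "\<delta> y \<le> dist x y"
        using \<delta>(2)[of y x] \<delta>(2)[of x y] xy by (auto simp: dist_commute)
      moreover have "dist x y \<le> dist x z + dist y z" by (rule dist_triangle2)
      moreover have "dist x y > 0" using xy by simp
      ultimately show False by linarith
    qed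
    then show "\<exists>f. (\<forall>x\<in>B. f x \<in> (\<lambda>B. X \<inter> closure B) ` \<B> \<and> x \<in> f x) \<and> disjoint_family_on f B"
      using f(1,2) unfolding disjoint_family_on_def by blast
  qed
qed

text \<open>Distinct points of a fiber can be enclosed in disjoint compact sets of the countable
  family, and conversely disjoint sets meeting the fiber yield distinct points. Continuous images of
  compact sets are closed, so the level set is the trace on \<open>Y\<close> of a countable union of
  closed sets.\<close>

lemma sets_enat_le_ecard_fiber:
  fixes p :: "'a::metric_space \<Rightarrow> 'b::metric_space"
  assumes K: "compact K" and p: "continuous_on K p"
  shows "{y \<in> Y. enat m \<le> ecard {x \<in> K. p x = y}} \<in> sets (restrict_space borel Y)"
proof -
  obtain \<C> where \<C>: "countable \<C>" "\<And>C. C \<in> \<C> \<Longrightarrow> compact C \<and> C \<subseteq> K"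
    "\<And>B. finite B \<Longrightarrow> B \<subseteq> K \<Longrightarrow> \<exists>f. (\<forall>x\<in>B. f x \<in> \<C> \<and> x \<in> f x) \<and> disjoint_family_on f B"
    using compact_countable_separating_family[OF K] by metis
  \<comment> \<open>For \<open>m = 0\<close> the only member is the empty family, whose intersection
    of images is everything, as the trivial bound requires.\<close>
  define \<F> where "\<F> = {D. D \<subseteq> \<C> \<and> finite D \<and> card D = m \<and> disjoint D}"
  have "countable \<F>"
    by (rule countable_subset[OF _ countable_Collect_finite_subset[OF \<C>(1)]]) (auto simp: \<F>_def)
  define Z where "Z = (\<Union>D\<in>\<F>. \<Inter>C\<in>D. p ` C)"
  have "closed (\<Inter>C\<in>D. p ` C)" if "D \<in> \<F>" for D
  proof (rule closed_INT, rule ballI)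
    fix C assume "C \<in> D"
    with that have "compact C" "C \<subseteq> K" using \<C>(2) by (auto simp: \<F>_def)
    then show "closed (p ` C)"
      using p by (intro compact_imp_closed compact_continuous_image) (auto intro: continuous_on_subset)
  qed
  then have "Z \<in> sets borel"
    unfolding Z_def using \<open>countable \<F>\<close> by (intro sets.countable_UN'') auto
  moreover have "{y \<in> Y. enat m \<le> ecard {x \<in> K. p x = y}} = Y \<inter> Z"
  proof (intro set_eqI iffI)
    fix y assume "y \<in> {y \<in> Y. enat m \<le> ecard {x \<in> K. p x = y}}"
    then obtain B where y: "y \<in> Y" and B: "B \<subseteq> {x \<in> K. p x = y}" "finite B" "card B = m"
      unfolding enat_le_ecard_iff by blast
    from B(1) have "B \<subseteq> K" by blast
    with \<C>(3)[OF B(2)] obtain f where f: "\<forall>x\<in>B. f x \<in> \<C> \<and> x \<in> f x" "disjoint_family_on f B"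
      by blast
    have "inj_on f B"
      using f unfolding inj_on_def disjoint_family_on_def by blast
    then have "f ` B \<in> \<F>"
      using f B by (auto simp: \<F>_def card_image disjoint_family_on_disjoint_image)
    moreover have "y \<in> (\<Inter>C\<in>f ` B. p ` C)" using f(1) B(1) by blast
    ultimately show "y \<in> Y \<inter> Z" using y unfolding Z_def by blast
  next
    fix y assume "y \<in> Y \<inter> Z"
    then obtain D where y: "y \<in> Y" and D: "D \<in> \<F>" "y \<in> (\<Inter>C\<in>D. p ` C)"
      unfolding Z_def by blast
    then have "\<forall>C\<in>D. \<exists>x\<in>C. p x = y" by blast
    then obtain g where g: "\<And>C. C \<in> D \<Longrightarrow> g C \<in> C" "\<And>C. C \<in> D \<Longrightarrow> p (g C) = y" by metis
    have "inj_on g D"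
    proof (rule inj_onI, rule ccontr)
      fix C C' assume "C \<in> D" "C' \<in> D" "g C = g C'" "C \<noteq> C'"
      moreover from this have "C \<inter> C' = {}" using D(1) by (auto simp: \<F>_def dest: disjointD)
      ultimately show False using g(1)[of C] g(1)[of C'] by auto
    qed
    then have "finite (g ` D)" "card (g ` D) = m" using D(1) by (auto simp: \<F>_def card_image)
    moreover have "g ` D \<subseteq> {x \<in> K. p x = y}"
    proof (rule image_subsetI)
      fix C assume "C \<in> D"
      moreover from this have "C \<subseteq> K" using D(1) \<C>(2) by (auto simp: \<F>_def)
      ultimately show "g C \<in> {x \<in> K. p x = y}" using g by blast
    qed
    ultimately show "y \<in> {y \<in> Y. enat m \<le> ecard {x \<in> K. p x = y}}"
      using y unfolding enat_le_ecard_iff by blast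
  qed
  ultimately show ?thesis by (auto simp: sets_restrict_space)
qed

text \<open>As \<open>enat\<close> is countable, singletons are enough: a finite value is a
  difference of two consecutive upper level sets, and \<open>\<infinity>\<close> is the intersection
  of all of them.\<close>

lemma measurable_enatI:
  fixes f :: "'c \<Rightarrow> enat"
  assumes "\<And>m. {y \<in> space N. enat m \<le> f y} \<in> sets N"
  shows "f \<in> measurable N (count_space UNIV)"
proof (subst measurable_count_space_eq2_countable, simp, safe)
  fix k :: enat
  show "f -` {k} \<inter> space N \<in> sets N"
  proof (cases k)
    case (enat m)
    have "f -` {k} \<inter> space N = {y \<in> space N. enat m \<le> f y} - {y \<in> space N. enat (Suc m) \<le> f y}"
    proof -
      have "f y = enat m \<longleftrightarrow> enat m \<le> f y \<and> \<not> enat (Suc m) \<le> f y" for y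
        by (cases "f y") auto
      then show ?thesis using enat by auto
    qed
    then show ?thesis using assms by auto
  next
    case infinity
    have "f y = \<infinity> \<longleftrightarrow> (\<forall>m. enat m \<le> f y)" for y
      by (cases "f y") (auto simp: not_le)
    then have "f -` {k} \<inter> space N = (\<Inter>m. {y \<in> space N. enat m \<le> f y})" using infinity by auto
    then show ?thesis using assms by auto
  qed
qed

lemma measurable_ecard_fiber:
  fixes p :: "'a::metric_space \<Rightarrow> 'b::metric_space"
  assumes "compact K" and "continuous_on K p"
  shows "(\<lambda>y. ecard {x \<in> K. p x = y}) \<in> measurable (restrict_space borel Y) (count_space UNIV)"
  using sets_enat_le_ecard_fiber[OF assms] by (intro measurable_enatI) (simp add: space_restrict_space)

section \<open>Counting fiber points in Borel sets and in product sets\<close>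

text \<open>Dynkin's argument: counts add over disjoint unions, and finiteness of \<open>F y\<close>
  permits subtraction for complements. The hypothesis \<open>total\<close> supplies the count of the
  whole fiber, since \<open>\<Omega>\<close> is not assumed to be in the generator.\<close>

lemma measurable_fiber_count_sigma_sets:
  assumes G: "Int_stable \<G>" "\<G> \<subseteq> Pow \<Omega>"
    and fin: "\<And>y. y \<in> space N \<Longrightarrow> finite (F y)"
    and sub: "\<And>y. y \<in> space N \<Longrightarrow> F y \<subseteq> \<Omega>"
    and total: "(\<lambda>y. emeasure (count_space UNIV) (F y)) \<in> borel_measurable N"
    and basic: "\<And>A. A \<in> \<G> \<Longrightarrow> (\<lambda>y. emeasure (count_space UNIV) (A \<inter> F y)) \<in> borel_measurable N"
    and A: "A \<in> sigma_sets \<Omega> \<G>"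
  shows "(\<lambda>y. emeasure (count_space UNIV) (A \<inter> F y)) \<in> borel_measurable N"
  using G A
proof (induction rule: sigma_sets_induct_disjoint)
  case (basic A)
  then show ?case by (rule assms(6))
next
  case empty
  then show ?case by simp
next
  case (compl A)
  have "(\<lambda>y. emeasure (count_space UNIV) (F y) - emeasure (count_space UNIV) (A \<inter> F y)) \<in> borel_measurable N"
    using total compl(2) by (rule borel_measurable_minus_ennreal)
  moreover have "emeasure (count_space UNIV) (F y) - emeasure (count_space UNIV) (A \<inter> F y)
      = emeasure (count_space UNIV) ((\<Omega> - A) \<inter> F y)" if "y \<in> space N" for y
  proof -
    have "(\<Omega> - A) \<inter> F y = F y - A \<inter> F y" using sub[OF that] by auto
    then show ?thesis using fin[OF that] by (simp add: emeasure_Diff)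
  qed
  ultimately show ?case by (simp cong: measurable_cong)
next
  case (union A)
  have "(\<lambda>y. \<Sum>i. emeasure (count_space UNIV) (A i \<inter> F y)) \<in> borel_measurable N"
    using union(3) by (rule borel_measurable_suminf_order)
  moreover have "(\<Sum>i. emeasure (count_space UNIV) (A i \<inter> F y))
      = emeasure (count_space UNIV) ((\<Union>i. A i) \<inter> F y)" for y
  proof -
    have "(\<Sum>i. emeasure (count_space UNIV) (A i \<inter> F y)) = emeasure (count_space UNIV) (\<Union>i. A i \<inter> F y)"
      using union(1) by (intro suminf_emeasure) (auto simp: disjoint_family_on_def)
    then show ?thesis by simp
  qed
  ultimately show ?case by simp
qed

text \<open>Traces of closed sets on a compact set are exactly its compact subsets. This gives an
  intersection-stable generator on which the fiber counts are already known to be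
  measurable.\<close>

lemma sets_restrict_borel_compact:
  fixes X :: "'a::metric_space set"
  assumes "compact X"
  shows "sets (restrict_space borel X) = sigma_sets X {K. compact K \<and> K \<subseteq> X}"
proof -
  have "X \<in> sigma_sets UNIV (Collect closed)"
    using assms by (intro sigma_sets.Basic) (simp add: compact_imp_closed)
  then have "(\<inter>) X ` sigma_sets UNIV (Collect closed) = sigma_sets X ((\<inter>) X ` Collect closed)"
    by (rule sigma_sets_Int) simp
  moreover have "(\<inter>) X ` Collect closed = {K. compact K \<and> K \<subseteq> X}"
  proof (intro set_eqI iffI)
    fix K assume "K \<in> {K. compact K \<and> K \<subseteq> X}"
    then show "K \<in> (\<inter>) X ` Collect closed"
      by (intro image_eqI[of _ _ K]) (auto simp: compact_imp_closed)
  qed (use assms in auto)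
  ultimately show ?thesis by (simp add: sets_restrict_space borel_eq_closed)
qed

text \<open>For compact \<open>K\<close> the count is the fiber cardinality of \<open>p\<close>
  restricted to \<open>K\<close>; Dynkin's lemma extends this to Borel sets. Emptying the fibers
  outside \<open>Z\<close> makes all of them finite without losing measurability.\<close>

lemma measurable_fiber_count:
  fixes p :: "'a::metric_space \<Rightarrow> 'b::metric_space"
  assumes X: "compact X" and p: "continuous_on X p"
    and Z: "Z \<in> sets (restrict_space borel Y)"
    and fin: "\<And>y. y \<in> Z \<Longrightarrow> finite {x \<in> X. p x = y}"
    and A: "A \<in> sets (restrict_space borel X)"
  shows "(\<lambda>y. emeasure (count_space UNIV) (A \<inter> (if y \<in> Z then {x \<in> X. p x = y} else {})))
    \<in> borel_measurable (restrict_space borel Y)"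
proof (rule measurable_fiber_count_sigma_sets)
  let ?F = "\<lambda>y. if y \<in> Z then {x \<in> X. p x = y} else {}"
  show "Int_stable {K. compact K \<and> K \<subseteq> X}"
    by (auto simp: Int_stable_def)
  show *: "(\<lambda>y. emeasure (count_space UNIV) (K \<inter> ?F y)) \<in> borel_measurable (restrict_space borel Y)"
    if "K \<in> {K. compact K \<and> K \<subseteq> X}" for K
  proof -
    have "(\<lambda>y. ecard {x \<in> K. p x = y}) \<in> measurable (restrict_space borel Y) (count_space UNIV)"
      using that p by (intro measurable_ecard_fiber) (auto intro: continuous_on_subset)
    then have "(\<lambda>y. emeasure (count_space UNIV) {x \<in> K. p x = y}) \<in> borel_measurable (restrict_space borel Y)"
      unfolding emeasure_count_space_UNIV_ecard by (rule measurable_compose) simp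
    then have "(\<lambda>y. if y \<in> Z then emeasure (count_space UNIV) {x \<in> K. p x = y} else 0)
        \<in> borel_measurable (restrict_space borel Y)"
      using Z by (intro measurable_If_set) (auto simp: sets.Int_space_eq2)
    also have "(\<lambda>y. if y \<in> Z then emeasure (count_space UNIV) {x \<in> K. p x = y} else 0)
        = (\<lambda>y. emeasure (count_space UNIV) (K \<inter> ?F y))"
    proof
      fix y
      have "K \<inter> {x \<in> X. p x = y} = {x \<in> K. p x = y}" using that by auto
      then show "(if y \<in> Z then emeasure (count_space UNIV) {x \<in> K. p x = y} else 0)
          = emeasure (count_space UNIV) (K \<inter> ?F y)" by simp
    qed
    finally show ?thesis .
  qed
  \<comment> \<open>The compact set \<open>X\<close> itself belongs to the generator, so the total
    count is the case \<open>K = X\<close>.\<close>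
  have "X \<inter> ?F y = ?F y" for y by auto
  then show "(\<lambda>y. emeasure (count_space UNIV) (?F y)) \<in> borel_measurable (restrict_space borel Y)"
    using *[of X] X by simp
  show "A \<in> sigma_sets X {K. compact K \<and> K \<subseteq> X}"
    using A sets_restrict_borel_compact[OF X] by simp
qed (use fin in auto)

text \<open>On a box the count is the product of the counts in the coordinates, and the boxes form
  an intersection-stable generator of the product sigma-algebra.\<close>

lemma measurable_fiber_count_PiE:
  assumes I: "finite I"
    and fin: "\<And>y. y \<in> space N \<Longrightarrow> finite (F y)"
    and sub: "\<And>y. y \<in> space N \<Longrightarrow> F y \<subseteq> space M"
    and meas: "\<And>A. A \<in> sets M \<Longrightarrow> (\<lambda>y. emeasure (count_space UNIV) (A \<inter> F y)) \<in> borel_measurable N"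
    and A: "A \<in> sets (Pi\<^sub>M I (\<lambda>_. M))"
  shows "(\<lambda>y. emeasure (count_space UNIV) (A \<inter> Pi\<^sub>E I (\<lambda>_. F y))) \<in> borel_measurable N"
proof (rule measurable_fiber_count_sigma_sets)
  show "Int_stable (prod_algebra I (\<lambda>_. M))" by (rule Int_stable_prod_algebra)
  show "prod_algebra I (\<lambda>_. M) \<subseteq> Pow (Pi\<^sub>E I (\<lambda>_. space M))" by (rule prod_algebra_sets_into_space)
  show "A \<in> sigma_sets (Pi\<^sub>E I (\<lambda>_. space M)) (prod_algebra I (\<lambda>_. M))"
    using A by (simp add: sets_PiM)
  show "finite (Pi\<^sub>E I (\<lambda>_. F y))" if "y \<in> space N" for y
    using I fin[OF that] by (intro finite_PiE)
  show "Pi\<^sub>E I (\<lambda>_. F y) \<subseteq> Pi\<^sub>E I (\<lambda>_. space M)" if "y \<in> space N" for y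
    using sub[OF that] by (intro PiE_mono)
  have box: "(\<lambda>y. emeasure (count_space UNIV) (Pi\<^sub>E I E \<inter> Pi\<^sub>E I (\<lambda>_. F y))) \<in> borel_measurable N"
    if E: "\<And>i. i \<in> I \<Longrightarrow> E i \<in> sets M" for E
  proof -
    have "(\<lambda>y. \<Prod>i\<in>I. emeasure (count_space UNIV) (E i \<inter> F y)) \<in> borel_measurable N"
      using meas[OF E] by (rule borel_measurable_prod_ennreal)
    moreover have "(\<Prod>i\<in>I. emeasure (count_space UNIV) (E i \<inter> F y))
        = emeasure (count_space UNIV) (Pi\<^sub>E I E \<inter> Pi\<^sub>E I (\<lambda>_. F y))" if "y \<in> space N" for y
      using fin[OF that] I by (simp add: PiE_Int finite_PiE card_PiE)
    ultimately show ?thesis by (simp cong: measurable_cong)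
  qed
  show "(\<lambda>y. emeasure (count_space UNIV) (B \<inter> Pi\<^sub>E I (\<lambda>_. F y))) \<in> borel_measurable N"
    if "B \<in> prod_algebra I (\<lambda>_. M)" for B
    using that box unfolding prod_algebra_eq_finite[OF I] by auto
  have "Pi\<^sub>E I (\<lambda>_. space M) \<inter> Pi\<^sub>E I (\<lambda>_. F y) = Pi\<^sub>E I (\<lambda>_. F y)" if "y \<in> space N" for y
    using sub[OF that] by (auto simp: PiE_iff)
  then show "(\<lambda>y. emeasure (count_space UNIV) (Pi\<^sub>E I (\<lambda>_. F y))) \<in> borel_measurable N"
    using box[of "\<lambda>_. space M"] by (simp cong: measurable_cong)
qed

section \<open>Diagonals, product maps and the action on fibers\<close>

text \<open>Two points of \<open>X\<close> differ iff some member of a countable base contains the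
  first but not the second. The base comes from the compactness of \<open>X\<close>, as the ambient
  type need not be second countable.\<close>

lemma sets_Collect_eq_compact:
  fixes X :: "'a::metric_space set"
  assumes X: "compact X" and f: "f \<in> measurable M (restrict_space borel X)"
    and g: "g \<in> measurable M (restrict_space borel X)"
  shows "{x \<in> space M. f x = g x} \<in> sets M"
proof -
  obtain \<B> where \<B>: "countable \<B>" "\<And>B. B \<in> \<B> \<Longrightarrow> openin (top_of_set X) B"
    "\<And>U x. openin (top_of_set X) U \<Longrightarrow> x \<in> U \<Longrightarrow> \<exists>B\<in>\<B>. x \<in> B \<and> B \<subseteq> U"
    using compact_countable_base[OF X] by metis
  have in_X: "f x \<in> X" "g x \<in> X" if "x \<in> space M" for x
    using measurable_space[OF f that] measurable_space[OF g that] by (auto simp: space_restrict_space)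
  have "space M - (\<Union>B\<in>\<B>. (f -` B \<inter> space M) - (g -` B \<inter> space M)) = {x \<in> space M. f x = g x}"
  proof -
    have "\<exists>B\<in>\<B>. f x \<in> B \<and> g x \<notin> B" if "x \<in> space M" "f x \<noteq> g x" for x
    proof -
      have "openin (top_of_set X) (X - {g x})"
        by (auto simp: openin_open intro!: exI[of _ "- {g x}"])
      then show ?thesis using \<B>(3)[of "X - {g x}" "f x"] in_X(1)[OF that(1)] that(2) by blast
    qed
    then show ?thesis by (intro set_eqI iffI) (simp, blast, simp)
  qed
  moreover have "(f -` B \<inter> space M) - (g -` B \<inter> space M) \<in> sets M" if B: "B \<in> \<B>" for B
  proof -
    obtain W where "open W" "B = X \<inter> W" using \<B>(2)[OF B] by (auto simp: openin_open)
    then have "B \<in> sets (restrict_space borel X)" by (auto simp: sets_restrict_space)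
    then show ?thesis by (intro sets.Diff measurable_sets[OF f] measurable_sets[OF g])
  qed
  with \<B>(1) have "(\<Union>B\<in>\<B>. (f -` B \<inter> space M) - (g -` B \<inter> space M)) \<in> sets M"
    by (rule sets.countable_UN'')
  then have "space M - (\<Union>B\<in>\<B>. (f -` B \<inter> space M) - (g -` B \<inter> space M)) \<in> sets M" by blast
  ultimately show ?thesis by simp
qed

text \<open>The inverse is the product map of \<open>inv_into A T\<close>; a bijection applied
  coordinatewise keeps coordinates distinct in both directions.\<close>

lemma bij_betw_power_map:
  assumes "bij_betw T A B"
  shows "bij_betw (power_map n T) {x \<in> Pi\<^sub>E {..<n} (\<lambda>_. A). inj_on x {..<n}}
    {x \<in> Pi\<^sub>E {..<n} (\<lambda>_. B). inj_on x {..<n}}"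
proof (rule bij_betw_byWitness[where f' = "power_map n (inv_into A T)"])
  have map_in: "power_map n f ` {x \<in> Pi\<^sub>E {..<n} (\<lambda>_. C). inj_on x {..<n}}
      \<subseteq> {x \<in> Pi\<^sub>E {..<n} (\<lambda>_. D). inj_on x {..<n}}"
    if f: "bij_betw f C D" for f C D
  proof (rule image_subsetI)
    fix x assume x: "x \<in> {x \<in> Pi\<^sub>E {..<n} (\<lambda>_. C). inj_on x {..<n}}"
    then have xC: "\<And>i. i < n \<Longrightarrow> x i \<in> C" by (auto simp: PiE_iff)
    have "inj_on (power_map n f x) {..<n}"
    proof (rule inj_onI)
      fix i j assume ij: "i \<in> {..<n}" "j \<in> {..<n}" "power_map n f x i = power_map n f x j"
      then have "x i = x j"
        using f xC[of i] xC[of j] by (auto simp: power_map_def bij_betw_def dest: inj_onD)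
      with x ij show "i = j" by (auto dest: inj_onD)
    qed
    then show "power_map n f x \<in> {x \<in> Pi\<^sub>E {..<n} (\<lambda>_. D). inj_on x {..<n}}"
      using xC bij_betwE[OF f] by (auto simp: power_map_def)
  qed
  show "power_map n T ` {x \<in> Pi\<^sub>E {..<n} (\<lambda>_. A). inj_on x {..<n}}
      \<subseteq> {x \<in> Pi\<^sub>E {..<n} (\<lambda>_. B). inj_on x {..<n}}"
    using assms by (rule map_in)
  show "power_map n (inv_into A T) ` {x \<in> Pi\<^sub>E {..<n} (\<lambda>_. B). inj_on x {..<n}}
      \<subseteq> {x \<in> Pi\<^sub>E {..<n} (\<lambda>_. A). inj_on x {..<n}}"
    using bij_betw_inv_into[OF assms] by (rule map_in)
  show "\<forall>x\<in>{x \<in> Pi\<^sub>E {..<n} (\<lambda>_. A). inj_on x {..<n}}. power_map n (inv_into A T) (power_map n T x) = x"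
  proof
    fix x assume "x \<in> {x \<in> Pi\<^sub>E {..<n} (\<lambda>_. A). inj_on x {..<n}}"
    then have x: "x \<in> Pi\<^sub>E {..<n} (\<lambda>_. A)" by simp
    show "power_map n (inv_into A T) (power_map n T x) = x"
    proof
      fix i
      \<comment> \<open>For \<open>i \<ge> n\<close> both sides are \<open>undefined\<close>,
        because \<open>x\<close> is extensional.\<close>
      show "power_map n (inv_into A T) (power_map n T x) i = x i"
        using PiE_mem[OF x, of i] PiE_arb[OF x, of i] bij_betw_inv_into_left[OF assms, of "x i"]
        by (cases "i < n") (auto simp: power_map_def)
    qed
  qed
  show "\<forall>x\<in>{x \<in> Pi\<^sub>E {..<n} (\<lambda>_. B). inj_on x {..<n}}. power_map n T (power_map n (inv_into A T) x) = x"
  proof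
    fix x assume "x \<in> {x \<in> Pi\<^sub>E {..<n} (\<lambda>_. B). inj_on x {..<n}}"
    then have x: "x \<in> Pi\<^sub>E {..<n} (\<lambda>_. B)" by simp
    show "power_map n T (power_map n (inv_into A T) x) = x"
    proof
      fix i
      show "power_map n T (power_map n (inv_into A T) x) i = x i"
        using PiE_mem[OF x, of i] PiE_arb[OF x, of i] bij_betw_inv_into_right[OF assms, of "x i"]
        by (cases "i < n") (auto simp: power_map_def)
    qed
  qed
qed

lemma measurable_restrict_borel_continuous:
  assumes "continuous_on X f" and "\<And>x. x \<in> X \<Longrightarrow> f x \<in> Y"
  shows "f \<in> measurable (restrict_space borel X) (restrict_space borel Y)"
  using assms by (intro measurable_restrict_space2 borel_measurable_continuous_on_restrict)
    (auto simp: space_restrict_space)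

lemma measurable_power_map:
  assumes "T \<in> measurable (restrict_space borel X) (restrict_space borel X)"
  shows "power_map n T \<in> measurable (power_space n X) (power_space n X)"
  unfolding power_map_def power_space_def
  by (intro measurable_restrict measurable_compose[OF _ assms] measurable_component_singleton)

text \<open>Onto, because a point over \<open>S y\<close> has a \<open>T\<close>-preimage in
  \<open>X\<close>, and injectivity of \<open>S\<close> on \<open>Y\<close> forces that preimage to
  lie over \<open>y\<close>.\<close>

lemma fiber_bij_betw:
  assumes "factor_map X T Y S p" and y: "y \<in> Y"
  shows "bij_betw T {x \<in> X. p x = y} {x \<in> X. p x = S y}"
proof -
  from assms(1) obtain T' S' where hT: "homeomorphism X X T T'" and hS: "homeomorphism Y Y S S'"
    and pX: "p ` X = Y" and comm: "\<And>x. x \<in> X \<Longrightarrow> p (T x) = S (p x)"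
    by (auto simp: factor_map_def tds_def)
  have "inj_on T {x \<in> X. p x = y}"
    by (rule inj_on_inverseI[of _ T']) (use hT in \<open>auto simp: homeomorphism_def\<close>)
  moreover have "T ` {x \<in> X. p x = y} = {x \<in> X. p x = S y}"
  proof (intro set_eqI iffI)
    fix x assume "x \<in> T ` {x \<in> X. p x = y}"
    then show "x \<in> {x \<in> X. p x = S y}"
      using comm hT by (auto simp: homeomorphism_def)
  next
    fix x assume "x \<in> {x \<in> X. p x = S y}"
    then have x: "x \<in> X" "p x = S y" by auto
    have T': "T' x \<in> X" "T (T' x) = x" using hT x(1) by (auto simp: homeomorphism_def)
    have "S (p (T' x)) = S y" using comm[OF T'(1)] T'(2) x(2) by simp
    moreover have "p (T' x) \<in> Y" using T'(1) pX by auto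
    ultimately have "p (T' x) = y" using hS y unfolding homeomorphism_def by metis
    then show "x \<in> T ` {x \<in> X. p x = y}" using T' by (intro image_eqI[of _ _ "T' x"]) auto
  qed
  ultimately show ?thesis by (simp add: bij_betw_def)
qed

section \<open>Construction of the degree joining from enumerations of fibers\<close>

theorem theorem4p4:
  fixes X :: "'a::metric_space set" and T :: "'a \<Rightarrow> 'a"
    and Y :: "'b::metric_space set" and S :: "'b \<Rightarrow> 'b"
    and \<pi> :: "'a \<Rightarrow> 'b" and \<nu> :: "'b measure"
  assumes "factor_quadruple X T Y S \<pi> \<nu>"
    and "fiber_degree X \<pi> \<nu> < \<infinity>"
  shows "\<exists>J. degree_joining X T Y \<pi> \<nu> J"
proof -
  let ?BX = "restrict_space borel X" and ?N = "restrict_space borel Y"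
  from assms(1) have fm: "factor_map X T Y S \<pi>" and erg: "\<nu> \<in> ergodic_measures ?N S"
    by (auto simp: factor_quadruple_def)
  from fm have X: "compact X" and Y: "compact Y" and cont: "continuous_on X \<pi>" and \<pi>X: "\<pi> ` X = Y"
    by (auto simp: factor_map_def tds_def)
  from fm have T: "continuous_on X T" "T ` X = X" and SY: "S ` Y = Y"
    by (auto simp: factor_map_def tds_def homeomorphism_def)
  from erg have sets: "sets \<nu> = sets ?N" and "prob_space \<nu>"
    by (auto simp: ergodic_measures_def invariant_measures_def)
  interpret prob_space \<nu> by fact
  have sp: "space \<nu> = Y" using sets_eq_imp_space_eq[OF sets] by (simp add: space_restrict_space)
  have spN: "space ?N = Y" by (simp add: space_restrict_space)
  define Fib where "Fib y = {x \<in> X. \<pi> x = y}" for y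
  have bij_Fib: "bij_betw T (Fib y) (Fib (S y))" if "y \<in> Y" for y
    using fiber_bij_betw[OF fm that] by (simp add: Fib_def)
  have ecard_Fib: "ecard (Fib (S y)) = ecard (Fib y)" if "y \<in> Y" for y
    using bij_betw_finite[OF bij_Fib[OF that]] bij_betw_same_card[OF bij_Fib[OF that]]
    by (simp add: ecard_def)
  have meas_ecard: "{y \<in> Y. ecard (Fib y) = k} \<in> sets ?N" for k
  proof -
    have "(\<lambda>y. ecard (Fib y)) -` {k} \<inter> space ?N \<in> sets ?N"
      unfolding Fib_def by (rule measurable_sets[OF measurable_ecard_fiber[OF X cont]]) simp
    moreover have "(\<lambda>y. ecard (Fib y)) -` {k} \<inter> space ?N = {y \<in> Y. ecard (Fib y) = k}"
      by (auto simp: spN)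
    ultimately show ?thesis by simp
  qed
  \<comment> \<open>Fiber cardinality is invariant under \<open>S\<close> and takes values in the
    countable type \<open>enat\<close>, so ergodicity makes it almost surely constant; this constant
    is the degree.\<close>
  obtain D where D: "AE y in \<nu>. ecard (Fib y) = D"
    by (rule ergodic_invariant_AE_const[OF erg, of "\<lambda>y. ecard (Fib y)"])
      (use meas_ecard ecard_Fib in \<open>auto simp: spN\<close>)
  have degree: "fiber_degree X \<pi> \<nu> = D"
    using D by (intro fiber_degree_eqI prob_space_axioms) (simp add: Fib_def)
  with assms(2) obtain d where d: "D = enat d" by (cases D) auto
  define Z where "Z = {y \<in> Y. ecard (Fib y) = enat d}"
  have Z: "Z \<in> sets ?N" unfolding Z_def by (rule meas_ecard)
  have card_Fib: "finite (Fib y) \<and> card (Fib y) = d" if "y \<in> Z" for y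
    using that by (auto simp: Z_def ecard_def split: if_splits)
  have AE_Z: "AE y in \<nu>. y \<in> Z" using D AE_space by eventually_elim (simp add: Z_def d sp)
  \<comment> \<open>Fibers over \<open>Y\<close> are nonempty because \<open>\<pi>\<close> is onto.
    Positivity makes coordinate 0 available as the witness for \<open>joining_over\<close>.\<close>
  have "d > 0"
  proof -
    have "AE y in \<nu>. d > 0"
      using AE_Z
    proof eventually_elim
      case (elim y)
      then have "Fib y \<noteq> {}" using \<pi>X by (auto simp: Z_def Fib_def)
      then show ?case using card_Fib[OF elim] by (auto simp: card_gt_0_iff)
    qed
    then show ?thesis by simp
  qed
  \<comment> \<open>Discarding the exceptional fibers makes finiteness and equivariance hold for
    every point of \<open>Y\<close>, not just almost surely.\<close>
  define G where "G y = (if y \<in> Z then Fib y else {})" for y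
  have bij_G: "bij_betw T (G y) (G (S y))" if "y \<in> Y" for y
  proof -
    \<comment> \<open>The fibers over \<open>y\<close> and \<open>S y\<close> are either both kept
      or both emptied.\<close>
    have "S y \<in> Z \<longleftrightarrow> y \<in> Z" using ecard_Fib[OF that] that SY by (auto simp: Z_def)
    then show ?thesis using bij_Fib[OF that] by (simp add: G_def bij_betw_def)
  qed
  let ?M = "power_space d X" and ?R = "power_map d T"
  have proj: "(\<lambda>x. x i) \<in> measurable ?M ?BX" if "i < d" for i
    using that unfolding power_space_def by (intro measurable_component_singleton) simp
  have \<pi>_meas: "\<pi> \<in> measurable ?BX ?N"
    using cont \<pi>X by (intro measurable_restrict_borel_continuous) auto
  have \<pi>_proj: "(\<lambda>x. \<pi> (x i)) \<in> measurable ?M ?N" if "i < d" for i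
    by (rule measurable_compose[OF proj[OF that] \<pi>_meas])
  have R: "?R \<in> measurable ?M ?M"
    using T by (intro measurable_power_map measurable_restrict_borel_continuous) auto
  define W where "W = {x \<in> space ?M. \<forall>i<d. \<forall>j<d. i \<noteq> j \<longrightarrow> x i \<noteq> x j}"
  have W: "W \<in> sets ?M"
  proof -
    \<comment> \<open>The complement of finitely many diagonals, each measurable because
      \<open>X\<close> is compact.\<close>
    have "W = space ?M - (\<Union>i\<in>{..<d}. \<Union>j\<in>{..<d} - {i}. {x \<in> space ?M. x i = x j})"
      unfolding W_def by auto
    moreover have "{x \<in> space ?M. x i = x j} \<in> sets ?M" if "i < d" "j < d" for i j
      using sets_Collect_eq_compact[OF X proj[OF that(1)] proj[OF that(2)]] .
    ultimately show ?thesis by auto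
  qed
  have FP: "fiber_product d X \<pi> \<in> sets ?M"
  proof -
    have eq: "fiber_product d X \<pi>
        = space ?M - (\<Union>i\<in>{..<d}. \<Union>j\<in>{..<d}. space ?M - {x \<in> space ?M. \<pi> (x i) = \<pi> (x j)})"
      unfolding fiber_product_def space_power_space by auto
    have mem: "{x \<in> space ?M. \<pi> (x i) = \<pi> (x j)} \<in> sets ?M" if "i < d" "j < d" for i j
      by (rule sets_Collect_eq_compact[OF Y \<pi>_proj[OF that(1)] \<pi>_proj[OF that(2)]])
    show ?thesis
      unfolding eq using mem by (intro sets.Diff sets.finite_UN sets.top) auto
  qed
  \<comment> \<open>For \<open>y \<in> Z\<close> these are the enumerations of the fiber, since an
    injection from \<open>d\<close> indices into \<open>d\<close> points is onto.\<close>
  define F where "F y = {x \<in> Pi\<^sub>E {..<d} (\<lambda>_. G y). inj_on x {..<d}}" for y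
  have GX: "G y \<subseteq> X" for y by (auto simp: G_def Fib_def)
  have F_W: "F y = W \<inter> Pi\<^sub>E {..<d} (\<lambda>_. G y)" for y
  proof -
    have "Pi\<^sub>E {..<d} (\<lambda>_. G y) \<subseteq> space ?M"
      unfolding space_power_space using GX by (intro PiE_mono)
    then show ?thesis by (auto simp: F_def W_def inj_on_def)
  qed
  have G_fin: "finite (G y)" for y using card_Fib by (auto simp: G_def)
  have \<pi>F: "\<pi> (x i) = y" if "x \<in> F y" "i < d" for x y i
  proof -
    have "x i \<in> G y" using that by (auto simp: F_def PiE_iff)
    then show ?thesis by (auto simp: G_def Fib_def split: if_splits)
  qed
  have F_fin: "finite (F y)" for y
    unfolding F_W using G_fin by (intro finite_Int disjI2 finite_PiE) auto
  have F_sub: "F y \<subseteq> space ?M" for y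
    unfolding F_W W_def by auto
  have F_bij: "bij_betw ?R (F y) (F (S y))" if "y \<in> space ?N" for y
    unfolding F_def using that by (intro bij_betw_power_map bij_G) (simp add: spN)
  have F_meas: "(\<lambda>y. emeasure (count_space UNIV) (A \<inter> F y)) \<in> borel_measurable ?N"
    if A: "A \<in> sets ?M" for A
  proof -
    \<comment> \<open>By \<open>F_W\<close> the injectivity condition moves from the fiber into the
      measurable set, leaving a full power of \<open>G y\<close> to which the product count
      applies.\<close>
    have "(\<lambda>y. emeasure (count_space UNIV) ((A \<inter> W) \<inter> Pi\<^sub>E {..<d} (\<lambda>_. G y))) \<in> borel_measurable ?N"
    proof (rule measurable_fiber_count_PiE[where M = ?BX])
      show "A \<inter> W \<in> sets (Pi\<^sub>M {..<d} (\<lambda>_. ?BX))" using A W by (auto simp: power_space_def)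
      show "(\<lambda>y. emeasure (count_space UNIV) (B \<inter> G y)) \<in> borel_measurable ?N" if "B \<in> sets ?BX" for B
        unfolding G_def Fib_def using measurable_fiber_count[OF X cont Z _ that] card_Fib
        by (simp add: Fib_def)
    qed (use G_fin GX in \<open>auto simp: space_restrict_space\<close>)
    then show ?thesis unfolding F_W by (simp add: Int_assoc)
  qed
  have F_ne: "AE y in \<nu>. F y \<noteq> {}"
    using AE_Z
  proof eventually_elim
    case (elim y)
    then have "finite (G y)" "card (G y) = d" using card_Fib by (auto simp: G_def)
    then obtain h where h: "bij_betw h {0..<d} (G y)" using ex_bij_betw_nat_finite[of "G y"] by auto
    then have "inj_on h {..<d}" "\<And>i. i < d \<Longrightarrow> h i \<in> G y"
      by (auto simp: bij_betw_def lessThan_atLeast0)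
    \<comment> \<open>Restriction makes the enumeration extensional, as points of the power space
      must be.\<close>
    then have "restrict h {..<d} \<in> F y" unfolding F_def by (auto simp: inj_on_def)
    then show ?case by blast
  qed
  obtain L where L: "L \<in> ergodic_measures ?M ?R"
    and full: "\<And>A. A \<in> sets ?M \<Longrightarrow> (\<And>y. y \<in> space ?N \<Longrightarrow> F y \<subseteq> A) \<Longrightarrow> emeasure L A = 1"
    and push: "\<And>q. q \<in> measurable ?M ?N \<Longrightarrow> (\<And>y x. y \<in> space ?N \<Longrightarrow> x \<in> F y \<Longrightarrow> q x = y) \<Longrightarrow>
      distr L ?N q = \<nu>"
    using ergodic_finite_extension[OF erg R F_fin F_sub F_bij F_meas F_ne] by blast
  have inv: "L \<in> invariant_measures ?M ?R" using L by (simp add: ergodic_measures_def)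
  then have L_sets: "sets L = sets ?M" and "prob_space L" by (auto simp: invariant_measures_def)
  interpret L: prob_space L by fact
  \<comment> \<open>Every enumeration of a fiber lies in the fiber product and has distinct
    coordinates, so \<open>full\<close> applies here and again to \<open>W\<close>.\<close>
  have "emeasure L (fiber_product d X \<pi>) = 1"
  proof (rule full[OF FP])
    fix y
    have "F y \<subseteq> Pi\<^sub>E {..<d} (\<lambda>_. X)" unfolding F_W W_def space_power_space by auto
    then show "F y \<subseteq> fiber_product d X \<pi>" using \<pi>F by (auto simp: fiber_product_def)
  qed
  then have "relative_joining d X T \<pi> L"
    using inv by (simp add: relative_joining_def measure_def)
  moreover have "distr L ?N (\<lambda>x. \<pi> (x 0)) = \<nu>"
    using \<open>d > 0\<close> by (intro push \<pi>_proj \<pi>F)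
  then have "joining_over d Y \<pi> \<nu> L" using \<open>d > 0\<close> by (auto simp: joining_over_def)
  moreover have "emeasure L W = 1" by (rule full[OF W]) (auto simp: F_W)
  then have "AE x in L. x \<in> W"
    using W by (subst L.AE_in_set_eq_1) (auto simp: L_sets measure_def)
  then have "separating d L" unfolding separating_def by eventually_elim (simp add: W_def)
  ultimately show ?thesis using L degree d unfolding degree_joining_def by blast
qed

end
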